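(* Let $$\Upsilon:=\{(\delta,\gamma)\in\mathbb{R}^2 : \delta\ge1,\ \gamma\ge0,\ \delta+\gamma\ge2\}.$$ Let $w$ be a doubling weight, let $m,n\in\mathbb{N}$ be such that $m\le n$, and let $(\delta,\gamma)\in\Upsilon$. Then $$\frac{w_n(x)}{w_m(x)}\le\left(\frac nm\right)^\delta\left(1+\frac1{m\varphi(x)}\right)^\gamma,\qquad -1\le x\le1.\qquad( * )$$ Moreover, if $(\delta,\gamma)\in\mathbb{R}^2\setminus\Upsilon$, then there are doubling weights $w$ for which $( * )$ is not valid (i.e., $( * )$ fails for some $m\le n$ and some $x\in[-1,1]$).
   Context: A doubling weight is a nonnegative $w\in L_1[-1,1]$ (not a.e. zero), extended by $0$ outside $[-1,1]$, for which there is a constant $L$ (the doubling constant of $w$) with $\int_{2I}w\le L\int_I w$ for all intervals $I\subset[-1,1]$, where $2I$ is the interval with the same center as $I$ and twice its length. Let $\varphi(x)=\sqrt{1-x^2}$, $\rho_n(x)=n^{-1}\sqrt{1-x^2}+n^{-2}$, and $w_n(x)=\frac{1}{\rho_n(x)}\int_{x-\rho_n(x)}^{x+\rho_n(x)}w(u)\,du$. At $x=\pm1$, where $\varphi(x)=0$, the factor $(1+1/(m\varphi(x)))^\gamma$ is understood as its limit: $+\infty$ if $\gamma>0$, $1$ if $\gamma=0$, and $0$ if $\gamma<0$. *)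

theory Defs
  imports "HOL-Analysis.Analysis"
begin

text \<open>
  Intervals are taken to be nondegenerate and closed; endpoints do not affect the integrals.  The
  interval \<open>2I\<close> may leave \<open>[-1,1]\<close>; outside \<open>[-1,1]\<close> the weight is extended by zero.
\<close>

definition doubling_weight :: "(real \<Rightarrow> real) \<Rightarrow> bool" where
  "doubling_weight w \<longleftrightarrow>
     (\<forall>x. 0 \<le> w x) \<and>
     (\<forall>x. x \<notin> {-1..1} \<longrightarrow> w x = 0) \<and>
     w absolutely_integrable_on {-1..1} \<and>
     \<not> (AE x in lebesgue. w x = 0) \<and>
     (\<exists>L. \<forall>a b. -1 \<le> a \<and> a < b \<and> b \<le> 1 \<longrightarrow>
        (LINT u:{(a + b) / 2 - (b - a)..(a + b) / 2 + (b - a)}|lebesgue. w u)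
          \<le> L * (LINT u:{a..b}|lebesgue. w u))"

definition phi :: "real \<Rightarrow> real" where
  "phi x = sqrt (1 - x\<^sup>2)"

definition rho :: "nat \<Rightarrow> real \<Rightarrow> real" where
  "rho n x = sqrt (1 - x\<^sup>2) / real n + 1 / (real n)\<^sup>2"

text \<open>
  For a doubling weight, \<open>n \<ge> 1\<close> and \<open>x \<in> [-1,1]\<close> this average is strictly positive: by the
  doubling condition, a weight with zero integral over one nondegenerate subinterval of \<open>[-1,1]\<close>
  vanishes almost everywhere.  Quotients of averages are therefore genuine real quotients.
\<close>

definition avg_weight :: "(real \<Rightarrow> real) \<Rightarrow> nat \<Rightarrow> real \<Rightarrow> real" where
  "avg_weight w n x = 1 / rho n x * (LINT u:{x - rho n x..x + rho n x}|lebesgue. w u)"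

text \<open>
  The factor \<open>(1 + 1 / (m \<phi>(x)))\<^sup>\<gamma>\<close>; where \<open>\<phi>\<close> vanishes, i.e. at \<open>x = \<plusminus>1\<close>, it is read as its
  limit, which is why it takes extended real values.
\<close>

definition endpoint_factor :: "nat \<Rightarrow> real \<Rightarrow> real \<Rightarrow> ereal" where
  "endpoint_factor m \<gamma> x =
     (if phi x = 0 then (if \<gamma> > 0 then \<infinity> else if \<gamma> = 0 then 1 else 0)
      else ereal ((1 + 1 / (real m * phi x)) powr \<gamma>))"

definition Upsilon :: "(real \<times> real) set" where
  "Upsilon = {(\<delta>, \<gamma>). \<delta> \<ge> 1 \<and> \<gamma> \<ge> 0 \<and> \<delta> + \<gamma> \<ge> 2}"

end

theory Submission
  imports Defs
begin

text \<open>
  Since \<open>\<rho>\<^sub>n \<le> \<rho>\<^sub>m\<close>, the quotient \<open>w\<^sub>n(x) / w\<^sub>m(x)\<close> is at most \<open>A = \<rho>\<^sub>m(x) / \<rho>\<^sub>n(x)\<close>.  With \<open>t = n / m\<close>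
  and \<open>u = m \<phi>(x)\<close> one has \<open>A = t\<^sup>2 (u + 1) / (u t + 1)\<close>, so that both \<open>A \<le> t\<^sup>2\<close> and \<open>A \<le> t (1 + 1/u)\<close>;
  the geometric means of these two bounds give all of \<open>\<Upsilon>\<close>.  Conversely, for the weight \<open>y \<mapsto> \<bar>y - x\<bar>\<close> to
  the power \<open>-\<beta>\<close>, \<open>\<beta> < 1\<close>, the quotient at \<open>x\<close> is at least half the \<open>\<beta>\<close>-th power of \<open>A\<close>.  Letting \<open>n\<close> grow with \<open>m = 1\<close>, the
  choices \<open>x = 0\<close> (where \<open>A\<close> is of order \<open>n\<close>) and \<open>\<phi>(x) = 1/n\<close> (where \<open>A\<close> and the squared endpoint factor
  are both of order \<open>n\<^sup>2\<close>) force \<open>\<delta> \<ge> 1\<close> and \<open>\<delta> + \<gamma> \<ge> 2\<close>, while at \<open>x = 1\<close> the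
  right-hand side vanishes if \<open>\<gamma> < 0\<close>.
\<close>

section \<open>Ratios of the averaging radii\<close>

lemma rho_pos: "1 \<le> n \<Longrightarrow> \<bar>x\<bar> \<le> 1 \<Longrightarrow> 0 < rho n x"
  unfolding rho_def
  by (intro add_nonneg_pos) (auto simp: abs_square_le_1)

lemma rho_antimono:
  assumes "1 \<le> m" "m \<le> n" "\<bar>x\<bar> \<le> 1"
  shows "rho n x \<le> rho m x"
  unfolding rho_def using assms
  by (intro add_mono divide_left_mono power_mono) (auto simp: abs_square_le_1)

lemma rho_ratio:
  assumes "1 \<le> m" "1 \<le> n" "\<bar>x\<bar> \<le> 1"
  shows "rho m x / rho n x
    = (real n / real m)\<^sup>2 * (real m * phi x + 1) / (real n * phi x + 1)"
proof -
  have s: "phi x \<ge> 0" using assms by (simp add: phi_def abs_square_le_1)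
  have eq: "rho k x = (real k * phi x + 1) / (real k)\<^sup>2" if "1 \<le> k" for k
    using that by (simp add: rho_def phi_def field_simps power2_eq_square)
  have "real n * phi x + 1 > 0" using s by (simp add: add_nonneg_pos)
  then show ?thesis using assms by (simp add: eq field_simps)
qed

lemma rho_ratio_le_square:
  assumes "1 \<le> m" "m \<le> n" "\<bar>x\<bar> \<le> 1"
  shows "rho m x / rho n x \<le> (real n / real m)\<^sup>2"
proof -
  have s: "phi x \<ge> 0" using assms by (simp add: phi_def abs_square_le_1)
  have "real m * phi x + 1 \<le> real n * phi x + 1"
    using assms s by (simp add: mult_right_mono)
  then have "(real m * phi x + 1) / (real n * phi x + 1) \<le> 1"
    using s by (simp add: divide_le_eq add_nonneg_pos)
  then have "(real n / real m)\<^sup>2 * ((real m * phi x + 1) / (real n * phi x + 1)) \<le> (real n / real m)\<^sup>2"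
    by (rule mult_left_le) simp
  then show ?thesis using assms by (simp add: rho_ratio)
qed

text \<open>Dropping the summand 1 from the denominator in \<open>rho_ratio\<close> leaves
  \<open>real n * phi x\<close>, which has to be positive; hence the strict bound on
  \<open>x\<close>.\<close>

lemma rho_ratio_le_linear:
  assumes "1 \<le> m" "1 \<le> n" "\<bar>x\<bar> < 1"
  shows "rho m x / rho n x \<le> real n / real m * (1 + 1 / (real m * phi x))"
proof -
  have s: "phi x > 0" using assms by (simp add: phi_def abs_square_less_1)
  have "rho m x / rho n x
      = (real n / real m)\<^sup>2 * (real m * phi x + 1) / (real n * phi x + 1)"
    using assms by (simp add: rho_ratio)
  also have "\<dots> \<le> (real n / real m)\<^sup>2 * (real m * phi x + 1) / (real n * phi x)"
    using assms s by (intro divide_left_mono) (auto simp: add_nonneg_pos)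
  also have "\<dots> = real n / real m * (1 + 1 / (real m * phi x))"
    using assms s by (simp add: field_simps power2_eq_square)
  finally show ?thesis .
qed

text \<open>The bounds on \<open>A\<close> are the exponent pairs (2, 0) and (1, 1). For
  \<open>\<gamma> < 1\<close>, weighting them by \<open>1 - \<gamma>\<close> and
  \<open>\<gamma>\<close> yields \<open>(2 - \<gamma>, \<gamma>)\<close>, and
  \<open>2 - \<gamma> \<le> \<delta>\<close>. For \<open>\<gamma> \<ge> 1\<close> the second bound
  suffices, since \<open>t\<close> and \<open>E\<close> are at least 1.\<close>

lemma geometric_interpolation:
  fixes A t E \<delta> \<gamma> :: real
  assumes "1 \<le> t" "1 \<le> E" "0 < A" "A \<le> t\<^sup>2" "A \<le> t * E" "1 \<le> \<delta>" "0 \<le> \<gamma>" "2 \<le> \<delta> + \<gamma>"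
  shows "A \<le> t powr \<delta> * E powr \<gamma>"
proof (cases "\<gamma> \<ge> 1")
  case True
  have "A \<le> t powr 1 * E powr 1" using assms by simp
  also have "\<dots> \<le> t powr \<delta> * E powr \<gamma>"
    using assms True by (intro mult_mono powr_mono) auto
  finally show ?thesis .
next
  case False
  have "A = A powr \<gamma> * A powr (1 - \<gamma>)" using assms by (simp flip: powr_add)
  also have "\<dots> \<le> (t * E) powr \<gamma> * (t\<^sup>2) powr (1 - \<gamma>)"
    using assms False by (intro mult_mono powr_mono2) auto
  also have "\<dots> = t powr (2 - \<gamma>) * E powr \<gamma>"
  proof -
    have "(t\<^sup>2) powr (1 - \<gamma>) = t powr (2 * (1 - \<gamma>))"
      using assms powr_powr[of t 2 "1 - \<gamma>"] by simp
    moreover have "t powr \<gamma> * t powr (2 * (1 - \<gamma>)) = t powr (2 - \<gamma>)"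
      by (simp flip: powr_add)
    ultimately show ?thesis using assms by (simp add: powr_mult mult.commute)
  qed
  also have "\<dots> \<le> t powr \<delta> * E powr \<gamma>"
    using assms by (intro mult_right_mono powr_mono) auto
  finally show ?thesis .
qed

section \<open>Upper bound for quotients of averages\<close>

lemma doubling_weight_integrable:
  assumes "doubling_weight w"
  shows "integrable lebesgue w"
proof -
  have "(\<lambda>x. indicator {-1..1} x *\<^sub>R w x) = w"
    using assms by (auto simp: doubling_weight_def fun_eq_iff indicator_def)
  then show ?thesis
    using assms unfolding doubling_weight_def set_integrable_def by auto
qed

lemma set_integrable_of_integrable:
  fixes f :: "real \<Rightarrow> real"
  assumes "integrable lebesgue f"
  shows "set_integrable lebesgue {a..b} f"
  using assms unfolding set_integrable_def
  by (intro integrable_mult_indicator) auto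

text \<open>The indicators let the set and the integrand change together, which serves both nested
  windows and truncated weights.\<close>

lemma set_integral_mono_indicator:
  fixes f g :: "'a \<Rightarrow> real"
  assumes "set_integrable M A f" "set_integrable M B g"
    and "\<And>x. indicator A x * f x \<le> indicator B x * g x"
  shows "(LINT x:A|M. f x) \<le> (LINT x:B|M. g x)"
  using assms unfolding set_integrable_def set_lebesgue_integral_def
  by (auto intro: integral_mono)

text \<open>The windows are nested, so the integrals contribute a factor of at most 1 and only the
  normalisations \<open>1 / rho\<close> remain.\<close>

lemma avg_weight_ratio_le:
  assumes w: "doubling_weight w" and mn: "1 \<le> m" "m \<le> n" and x: "\<bar>x\<bar> \<le> 1"
  shows "avg_weight w n x / avg_weight w m x \<le> rho m x / rho n x"
proof -
  define I where "I = (\<lambda>k. LINT u:{x - rho k x..x + rho k x}|lebesgue. w u)"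
  have w0: "0 \<le> w u" for u using w by (simp add: doubling_weight_def)
  have le: "I n \<le> I m" unfolding I_def
    using rho_antimono[OF mn x] w0 doubling_weight_integrable[OF w]
    by (intro set_integral_mono_indicator set_integrable_of_integrable)
       (auto simp: indicator_def)
  have "0 \<le> I n" unfolding I_def set_lebesgue_integral_def
    using w0 by (intro integral_nonneg_AE) auto
  \<comment> \<open>If \<open>I m = 0\<close>, the quotient is 0 by the convention for
    division.\<close>
  with le have "I n / I m \<le> 1" by (auto simp: divide_le_eq)
  moreover have pos: "rho m x / rho n x \<ge> 0"
    using rho_pos[of m x] rho_pos[of n x] mn x by simp
  ultimately have "rho m x / rho n x * (I n / I m) \<le> rho m x / rho n x"
    by (rule mult_left_le)
  then show ?thesis by (simp add: avg_weight_def I_def mult.commute)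
qed

lemma avg_weight_ratio_le_endpoint_factor:
  assumes w: "doubling_weight w" and mn: "1 \<le> m" "m \<le> n" and x: "\<bar>x\<bar> \<le> 1"
    and U: "(\<delta>, \<gamma>) \<in> Upsilon"
  shows "ereal (avg_weight w n x / avg_weight w m x)
    \<le> ereal ((real n / real m) powr \<delta>) * endpoint_factor m \<gamma> x"
proof -
  let ?A = "rho m x / rho n x" and ?t = "real n / real m"
  have t: "?t \<ge> 1" using mn by simp
  have A: "?A > 0" using rho_pos[of m x] rho_pos[of n x] mn x by simp
  have U': "1 \<le> \<delta>" "0 \<le> \<gamma>" "2 \<le> \<delta> + \<gamma>" using U by (auto simp: Upsilon_def)
  have sq: "?A \<le> ?t\<^sup>2" by (rule rho_ratio_le_square[OF mn x])
  have "ereal ?A \<le> ereal (?t powr \<delta>) * endpoint_factor m \<gamma> x"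
  proof (cases "\<bar>x\<bar> = 1")
    case True
    then have "phi x = 0" by (auto simp: phi_def abs_square_eq_1)
    \<comment> \<open>For \<open>\<gamma> > 0\<close> the endpoint factor is infinite. For
      \<open>\<gamma> = 0\<close> membership in \<open>Upsilon\<close> gives
      \<open>\<delta> \<ge> 2\<close>, so the square bound is enough.\<close>
    moreover have "?A \<le> ?t powr \<delta>" if "\<gamma> = 0"
    proof -
      note sq
      also have "?t\<^sup>2 = ?t powr 2" using mn by simp
      also have "\<dots> \<le> ?t powr \<delta>" using t U' that by (intro powr_mono) auto
      finally show ?thesis .
    qed
    ultimately show ?thesis using U'(2) mn by (auto simp: endpoint_factor_def)
  next
    case False
    then have x1: "\<bar>x\<bar> < 1" using x by simp
    then have s: "phi x > 0" by (simp add: phi_def abs_square_less_1)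
    have "?A \<le> ?t powr \<delta> * (1 + 1 / (real m * phi x)) powr \<gamma>"
      using t A sq U' rho_ratio_le_linear[of m n x] mn x1 s
      by (intro geometric_interpolation) auto
    then show ?thesis using s by (simp add: endpoint_factor_def)
  qed
  moreover have "ereal (avg_weight w n x / avg_weight w m x) \<le> ereal ?A"
    using avg_weight_ratio_le[OF w mn x] by simp
  ultimately show ?thesis by (rule order_trans[rotated])
qed

section \<open>Power functions with a pole\<close>

text \<open>Averages over radius \<open>r\<close> about \<open>c\<close> are proportional to
  \<open>r powr (-\<beta>)\<close>; with \<open>\<beta>\<close> near 1 this nearly exhausts the
  upper bound \<open>rho m x / rho n x\<close>.\<close>

definition pole :: "real \<Rightarrow> real \<Rightarrow> real \<Rightarrow> real" where
  "pole \<beta> c u = \<bar>u - c\<bar> powr (-\<beta>)"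

lemma pole_nonneg [simp]: "0 \<le> pole \<beta> c u"
  by (simp add: pole_def)

lemma pole_has_integral_right:
  assumes "\<beta> < 1" "0 \<le> r"
  shows "(pole \<beta> c has_integral r powr (1 - \<beta>) / (1 - \<beta>)) {c..c + r}"
proof -
  have "((\<lambda>x. x powr (-\<beta>)) has_integral r powr (-\<beta> + 1) / (-\<beta> + 1)) {0..r}"
    using assms by (intro has_integral_powr_from_0) auto
  then have "((pole \<beta> c \<circ> (+) c) has_integral r powr (1 - \<beta>) / (1 - \<beta>)) {0..r}"
    by (rule has_integral_eq[rotated, where f = "\<lambda>x. x powr (-\<beta>)", THEN has_integral_eq_rhs])
       (auto simp: pole_def)
  then show ?thesis
    by (simp only: has_integral_shift_Icc_real) (simp add: add.commute)
qed

lemma pole_has_integral_left: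
  assumes "\<beta> < 1" "0 \<le> r"
  shows "(pole \<beta> c has_integral r powr (1 - \<beta>) / (1 - \<beta>)) {c - r..c}"
proof -
  have "((\<lambda>u. pole \<beta> (-c) (-u)) has_integral r powr (1 - \<beta>) / (1 - \<beta>)) {c - r..c}"
    using has_integral_reflect_lemma_real[OF pole_has_integral_right[OF assms, of "-c"]] by simp
  moreover have "pole \<beta> (-c) (-u) = pole \<beta> c u" for u
    by (simp add: pole_def abs_minus_commute)
  ultimately show ?thesis by simp
qed

lemma pole_has_integral_symmetric:
  assumes "\<beta> < 1" "0 \<le> r"
  shows "(pole \<beta> c has_integral 2 * r powr (1 - \<beta>) / (1 - \<beta>)) {c - r..c + r}"
  using has_integral_combine[OF _ _ pole_has_integral_left[OF assms] pole_has_integral_right[OF assms]]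
    assms by simp

lemma pole_set_integrable:
  assumes "\<beta> < 1"
  shows "set_integrable lebesgue {a..b} (pole \<beta> c)"
proof -
  \<comment> \<open>The symmetric interval of this radius about \<open>c\<close> contains
    \<open>{a..b}\<close>.\<close>
  define r where "r = \<bar>a - c\<bar> + \<bar>b - c\<bar>"
  have "pole \<beta> c absolutely_integrable_on {c - r..c + r}"
    using pole_has_integral_symmetric[OF assms, of r c]
    by (intro nonnegative_absolutely_integrable_1) (auto simp: r_def)
  then show ?thesis by (rule set_integrable_subset) (auto simp: r_def)
qed

lemma LINT_pole_left:
  assumes "\<beta> < 1" "0 \<le> r"
  shows "(LINT u:{c - r..c}|lebesgue. pole \<beta> c u) = r powr (1 - \<beta>) / (1 - \<beta>)"
  using pole_has_integral_left[OF assms] set_lebesgue_integral_eq_integral(2)[OF pole_set_integrable]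
    assms by (simp add: integral_unique)

lemma LINT_pole_symmetric:
  assumes "\<beta> < 1" "0 \<le> r"
  shows "(LINT u:{c - r..c + r}|lebesgue. pole \<beta> c u) = 2 * r powr (1 - \<beta>) / (1 - \<beta>)"
  using pole_has_integral_symmetric[OF assms] set_lebesgue_integral_eq_integral(2)[OF pole_set_integrable]
    assms by (simp add: integral_unique)

lemma LINT_const_Icc:
  fixes k :: real
  assumes "a \<le> b"
  shows "(LINT u:{a..b}|lebesgue. k) = (b - a) * k"
  using assms by (simp add: set_integral_const)

lemma set_integrable_const_Icc: "set_integrable lebesgue {a..b::real} (\<lambda>u. k::real)"
  by (simp add: absolutely_integrable_on_const)

lemma LINT_pole_ge:
  assumes "\<beta> < 1" "0 \<le> \<beta>" "a < b" "\<And>u. u \<in> {a..b} \<Longrightarrow> \<bar>u - c\<bar> \<le> d"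
  shows "(b - a) * d powr (-\<beta>) \<le> (LINT u:{a..b}|lebesgue. pole \<beta> c u)"
proof -
  \<comment> \<open>At \<open>u = c\<close> the pole takes the junk value \<open>0\<close>, hence the comparison only almost everywhere.\<close>
  have "AE u in lebesgue. u \<noteq> c"
    by (rule AE_I'[of "{c}"]) auto
  then have "AE u\<in>{a..b} in lebesgue. d powr (-\<beta>) \<le> pole \<beta> c u"
    by eventually_elim (use assms in \<open>auto simp: pole_def intro: powr_mono2'\<close>)
  then have "(LINT u:{a..b}|lebesgue. d powr (-\<beta>)) \<le> (LINT u:{a..b}|lebesgue. pole \<beta> c u)"
    using pole_set_integrable[OF assms(1)] set_integrable_const_Icc
    by (intro set_integral_mono_AE) auto
  then show ?thesis using assms(3) by (simp add: LINT_const_Icc)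
qed

text \<open>As \<open>d\<close> is positive, the interval avoids \<open>c\<close> and the comparison
  is pointwise.\<close>

lemma LINT_pole_le:
  assumes "\<beta> < 1" "0 \<le> \<beta>" "a < b" "0 < d" "\<And>u. u \<in> {a..b} \<Longrightarrow> d \<le> \<bar>u - c\<bar>"
  shows "(LINT u:{a..b}|lebesgue. pole \<beta> c u) \<le> (b - a) * d powr (-\<beta>)"
proof -
  have "(LINT u:{a..b}|lebesgue. pole \<beta> c u) \<le> (LINT u:{a..b}|lebesgue. d powr (-\<beta>))"
  proof (rule set_integral_mono[OF pole_set_integrable[OF assms(1)] set_integrable_const_Icc])
    show "pole \<beta> c u \<le> d powr (-\<beta>)" if "u \<in> {a..b}" for u
      using assms that by (auto simp: pole_def intro!: powr_mono2')
  qed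
  then show ?thesis using assms(3) by (simp add: LINT_const_Icc)
qed

text \<open>Far from the pole the function is nearly constant on both intervals; near it, the mass
  about \<open>c\<close> is computed exactly. The constant is the sum of those from the two
  cases.\<close>

lemma pole_doubling:
  assumes b: "\<beta> < 1" "0 \<le> \<beta>" and r: "0 < r"
  shows "(LINT u:{y - 2 * r..y + 2 * r}|lebesgue. pole \<beta> c u)
    \<le> (8 + 6 / (1 - \<beta>)) * (LINT u:{y - r..y + r}|lebesgue. pole \<beta> c u)"
    (is "?J \<le> _ * ?I")
proof -
  have nonneg: "0 \<le> ?I" unfolding set_lebesgue_integral_def
    by (intro integral_nonneg_AE) auto
  define D where "D = \<bar>y - c\<bar>"
  have "?J \<le> 8 * ?I \<or> ?J \<le> 6 / (1 - \<beta>) * ?I"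
  proof (cases "4 * r \<le> D")
    case True
    have "?J \<le> (4 * r) * (D / 2) powr (-\<beta>)"
    proof -
      have "D / 2 \<le> \<bar>u - c\<bar>" if "u \<in> {y - 2 * r..y + 2 * r}" for u
      proof -
        have "\<bar>y - u\<bar> \<le> 2 * r" using that by auto
        moreover have "D \<le> \<bar>y - u\<bar> + \<bar>u - c\<bar>"
          using abs_triangle_ineq[of "y - u" "u - c"] by (simp add: D_def)
        ultimately show ?thesis using True by linarith
      qed
      then show ?thesis
        using LINT_pole_le[OF b, of "y - 2 * r" "y + 2 * r" "D / 2" c] True r by simp
    qed
    \<comment> \<open>On the large interval the distance to \<open>c\<close> is at least
      \<open>D / 2\<close>, on the small one at most \<open>2 * D\<close>. This ratio 4 costs
      \<open>4 powr \<beta> \<le> 4\<close>, and the lengths cost another 2, giving 8.\<close>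
    also have "(D / 2) powr (-\<beta>) = 4 powr \<beta> * (2 * D) powr (-\<beta>)"
    proof -
      have "(D / 2) powr (-\<beta>) = (1 / 4) powr (-\<beta>) * (2 * D) powr (-\<beta>)"
        using True r by (simp flip: powr_mult)
      then show ?thesis by (simp add: powr_minus powr_divide)
    qed
    also have "4 * r * (4 powr \<beta> * (2 * D) powr (-\<beta>)) = 2 * 4 powr \<beta> * (2 * r * (2 * D) powr (-\<beta>))"
      by simp
    also have "\<dots> \<le> 8 * (2 * r * (2 * D) powr (-\<beta>))"
      using powr_mono[of \<beta> 1 4] b r by (intro mult_right_mono) auto
    also have "\<dots> \<le> 8 * ?I"
    proof -
      have "\<bar>u - c\<bar> \<le> 2 * D" if "u \<in> {y - r..y + r}" for u
      proof -
        have "\<bar>u - y\<bar> \<le> r" using that by auto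
        moreover have "\<bar>u - c\<bar> \<le> \<bar>u - y\<bar> + D"
          using abs_triangle_ineq[of "u - y" "y - c"] by (simp add: D_def)
        ultimately show ?thesis using True r by linarith
      qed
      then show ?thesis
        using LINT_pole_ge[OF b, of "y - r" "y + r" c "2 * D"] r by simp
    qed
    finally show ?thesis by simp
  next
    case False
    \<comment> \<open>Since \<open>D < 4 * r\<close>, the large interval lies within
      \<open>4 * r + 2 * r\<close> of \<open>c\<close>, and the small one within
      \<open>4 * r + r\<close>.\<close>
    have "?J \<le> (LINT u:{c - 6 * r..c + 6 * r}|lebesgue. pole \<beta> c u)"
      using False r
      by (intro set_integral_mono_indicator pole_set_integrable b) (auto simp: indicator_def D_def)
    also have "\<dots> = 2 * (6 * r) powr (1 - \<beta>) / (1 - \<beta>)"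
      using b r by (intro LINT_pole_symmetric) auto
    also have "(6 * r) powr (1 - \<beta>) = 6 * r * (6 * r) powr (-\<beta>)"
      using r powr_add[of "6 * r" 1 "-\<beta>"] by simp
    also have "2 * (6 * r * (6 * r) powr (-\<beta>)) / (1 - \<beta>)
        \<le> 2 * (6 * r * (5 * r) powr (-\<beta>)) / (1 - \<beta>)"
      using b r by (intro divide_right_mono mult_left_mono powr_mono2') auto
    also have "\<dots> = 6 / (1 - \<beta>) * (2 * r * (5 * r) powr (-\<beta>))"
      by simp
    also have "\<dots> \<le> 6 / (1 - \<beta>) * ?I"
    proof (rule mult_left_mono)
      have "\<bar>u - c\<bar> \<le> 5 * r" if "u \<in> {y - r..y + r}" for u
        using that False by (auto simp: D_def)
      then show "2 * r * (5 * r) powr (-\<beta>) \<le> ?I"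
        using LINT_pole_ge[OF b, of "y - r" "y + r" c "5 * r"] r by simp
    qed (use b in auto)
    finally show ?thesis by simp
  qed
  moreover have "0 \<le> 6 / (1 - \<beta>) * ?I" using nonneg b by simp
  ultimately show ?thesis using nonneg by (auto simp: distrib_right)
qed

section \<open>Poles truncated to [-1,1] as doubling weights\<close>

definition pole_weight :: "real \<Rightarrow> real \<Rightarrow> real \<Rightarrow> real" where
  "pole_weight \<beta> c u = indicator {-1..1} u * pole \<beta> c u"

lemma pole_weight_integrable:
  assumes "\<beta> < 1"
  shows "integrable lebesgue (pole_weight \<beta> c)"
  using pole_set_integrable[OF assms, of "-1" 1 c]
  unfolding set_integrable_def pole_weight_def by simp

lemma LINT_pole_weight_le:
  assumes "\<beta> < 1"
  shows "(LINT u:{a..b}|lebesgue. pole_weight \<beta> c u) \<le> (LINT u:{a..b}|lebesgue. pole \<beta> c u)"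
  using assms
  by (intro set_integral_mono_indicator pole_set_integrable set_integrable_of_integrable
      pole_weight_integrable) (auto simp: pole_weight_def indicator_def)

lemma LINT_pole_weight_eq:
  assumes "-1 \<le> a" "b \<le> 1"
  shows "(LINT u:{a..b}|lebesgue. pole_weight \<beta> c u) = (LINT u:{a..b}|lebesgue. pole \<beta> c u)"
  using assms by (intro set_lebesgue_integral_cong) (auto simp: pole_weight_def)

text \<open>Doubling passes from \<open>pole\<close> to its truncation: on an interval inside [-1,1]
  the integrals agree, while on the doubled interval, which may stick out, truncation only lowers
  the integral.\<close>

lemma doubling_weight_pole_weight:
  assumes b: "\<beta> < 1" "0 \<le> \<beta>" and c: "0 \<le> c" "c \<le> 1"
  shows "doubling_weight (pole_weight \<beta> c)"
  unfolding doubling_weight_def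
proof (intro conjI exI allI impI notI)
  show "pole_weight \<beta> c absolutely_integrable_on {-1..1}"
    using b by (intro set_integrable_of_integrable pole_weight_integrable)
next
  assume "AE x in lebesgue. pole_weight \<beta> c x = 0"
  \<comment> \<open>The hypotheses on \<open>c\<close> place \<open>{c - 1..c}\<close> inside
    [-1,1], where the mass is explicit and positive.\<close>
  then have "AE x in lebesgue. indicator {c - 1..c} x *\<^sub>R pole_weight \<beta> c x = 0"
    by eventually_elim simp
  then have "(LINT u:{c - 1..c}|lebesgue. pole_weight \<beta> c u) = 0"
    unfolding set_lebesgue_integral_def by (rule integral_eq_zero_AE)
  moreover have "(LINT u:{c - 1..c}|lebesgue. pole_weight \<beta> c u) = 1 / (1 - \<beta>)"
    using LINT_pole_left[of \<beta> 1 c] b c by (simp add: LINT_pole_weight_eq)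
  ultimately show False using b by simp
next
  fix x y :: real
  assume xy: "-1 \<le> x \<and> x < y \<and> y \<le> 1"
  define r where "r = (y - x) / 2"
  have ends: "x = (x + y) / 2 - r" "y = (x + y) / 2 + r" "y - x = 2 * r" "0 < r"
    using xy by (auto simp: r_def field_simps)
  have "(LINT u:{(x + y) / 2 - 2 * r..(x + y) / 2 + 2 * r}|lebesgue. pole_weight \<beta> c u)
      \<le> (LINT u:{(x + y) / 2 - 2 * r..(x + y) / 2 + 2 * r}|lebesgue. pole \<beta> c u)"
    using b by (intro LINT_pole_weight_le)
  also have "\<dots> \<le> (8 + 6 / (1 - \<beta>)) * (LINT u:{(x + y) / 2 - r..(x + y) / 2 + r}|lebesgue. pole \<beta> c u)"
    by (rule pole_doubling[OF b \<open>0 < r\<close>])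
  also have "(LINT u:{(x + y) / 2 - r..(x + y) / 2 + r}|lebesgue. pole \<beta> c u)
      = (LINT u:{x..y}|lebesgue. pole_weight \<beta> c u)"
    using xy ends(1,2) by (simp add: LINT_pole_weight_eq)
  finally show "(LINT u:{(x + y) / 2 - (y - x)..(x + y) / 2 + (y - x)}|lebesgue. pole_weight \<beta> c u)
      \<le> (8 + 6 / (1 - \<beta>)) * (LINT u:{x..y}|lebesgue. pole_weight \<beta> c u)"
    by (simp only: ends(3))
qed (auto simp: pole_weight_def)

text \<open>The factor 1/2 arises because \<open>x\<close> may be 1: only the left half of the small
  window is sure to lie in [-1,1], whereas the large window is bounded by both halves.\<close>

lemma avg_pole_weight_ratio_ge:
  assumes b: "\<beta> < 1" "0 \<le> \<beta>" and x: "0 \<le> x" "x \<le> 1" and n: "2 \<le> n" and m: "1 \<le> m" "m \<le> n"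
  shows "(rho m x / rho n x) powr \<beta> / 2
    \<le> avg_weight (pole_weight \<beta> x) n x / avg_weight (pole_weight \<beta> x) m x"
proof -
  define I where "I = (\<lambda>k. LINT u:{x - rho k x..x + rho k x}|lebesgue. pole_weight \<beta> x u)"
  have ab: "\<bar>x\<bar> \<le> 1" using x by simp
  have pn: "0 < rho n x" and pm: "0 < rho m x" using rho_pos[OF _ ab] m by auto
  have lower: "min 1 (rho k x) powr (1 - \<beta>) / (1 - \<beta>) \<le> I k" if "1 \<le> k" for k
  proof -
    \<comment> \<open>As \<open>0 \<le> x\<close>, moving left by at most 1 stays in [-1,1].\<close>
    let ?d = "min 1 (rho k x)"
    have d: "0 < ?d" using rho_pos[OF that ab] by simp
    have "?d powr (1 - \<beta>) / (1 - \<beta>) = (LINT u:{x - ?d..x}|lebesgue. pole_weight \<beta> x u)"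
      using LINT_pole_left[of \<beta> ?d x] b x d by (subst LINT_pole_weight_eq) auto
    also have "\<dots> \<le> I k" unfolding I_def using b d
      by (intro set_integral_mono_indicator set_integrable_of_integrable pole_weight_integrable)
         (auto simp: indicator_def pole_weight_def)
    finally show ?thesis .
  qed
  \<comment> \<open>\<open>rho 1 x\<close> can exceed 1, but from index 2 on the radius is at most
    3/4 and the minimum is the radius itself.\<close>
  have "rho n x \<le> rho 2 x" using rho_antimono[of 2 n x] n ab by simp
  also have "\<dots> \<le> 1"
  proof -
    have "sqrt (1 - x\<^sup>2) \<le> 1" by simp
    moreover have "rho 2 x = sqrt (1 - x\<^sup>2) / 2 + 1 / 4" by (simp add: rho_def)
    ultimately show ?thesis by linarith
  qed
  finally have "min 1 (rho n x) = rho n x" by simp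
  with lower[of n] n have In: "rho n x powr (1 - \<beta>) / (1 - \<beta>) \<le> I n" by simp
  have Im: "I m \<le> 2 * rho m x powr (1 - \<beta>) / (1 - \<beta>)" unfolding I_def
    using LINT_pole_weight_le[OF b(1)] LINT_pole_symmetric[OF b(1)] pm
    by (metis less_imp_le)
  \<comment> \<open>For \<open>m\<close> the lower bound serves only to make the denominator
    positive.\<close>
  have "0 < min 1 (rho m x) powr (1 - \<beta>) / (1 - \<beta>)" using b pm by simp
  with lower[of m] m have Im0: "0 < I m" by simp
  have "0 \<le> rho n x powr (1 - \<beta>) / (1 - \<beta>)" using b by simp
  with In have In0: "0 \<le> I n" by linarith
  have "(rho m x / rho n x) powr \<beta> / 2
      = rho m x / rho n x * ((rho n x powr (1 - \<beta>) / (1 - \<beta>)) / (2 * rho m x powr (1 - \<beta>) / (1 - \<beta>)))"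
    using pn pm b by (simp add: powr_divide powr_diff field_simps)
  also have "\<dots> \<le> rho m x / rho n x * (I n / I m)"
    using In Im Im0 In0 pn pm b by (intro mult_left_mono frac_le) auto
  also have "\<dots> = avg_weight (pole_weight \<beta> x) n x / avg_weight (pole_weight \<beta> x) m x"
    by (simp add: avg_weight_def I_def)
  finally show ?thesis .
qed

section \<open>Sharpness of the exponent region\<close>

lemma powr_eventually_dominates:
  fixes C p q :: real
  assumes "p < q"
  shows "\<exists>n\<ge>2. C * real n powr p < real n powr q"
proof -
  have "filterlim (\<lambda>n. real n powr (q - p)) at_top sequentially"
    using assms by (intro filterlim_compose[OF real_powr_at_top filterlim_real_sequentially]) auto
  then have "eventually (\<lambda>n. C < real n powr (q - p)) sequentially"
    by (simp add: filterlim_at_top_dense)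
  then have "eventually (\<lambda>n. C < real n powr (q - p) \<and> 2 \<le> n) sequentially"
    using eventually_ge_at_top[of 2] by (rule eventually_conj)
  then obtain n where n: "C < real n powr (q - p)" "2 \<le> n"
    by (auto simp: eventually_sequentially)
  then have "C * real n powr p < real n powr (q - p) * real n powr p" by simp
  also have "\<dots> = real n powr q" by (simp flip: powr_add)
  finally show ?thesis using n by blast
qed

text \<open>Removes the weight from the problem: what remains is an inequality between powers of the
  radii and the claimed bound.\<close>

lemma pole_weight_counterexample:
  assumes "0 \<le> \<beta>" "\<beta> < 1" "0 \<le> x" "x \<le> 1" "2 \<le> n" "1 \<le> m" "m \<le> n"
    and "ereal ((real n / real m) powr \<delta>) * endpoint_factor m \<gamma> x
      < ereal ((rho m x / rho n x) powr \<beta> / 2)"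
  shows "\<exists>w. doubling_weight w \<and>
    (\<exists>m n. 1 \<le> m \<and> m \<le> n \<and>
      (\<exists>x\<in>{-1..1}. \<not> ereal (avg_weight w n x / avg_weight w m x)
        \<le> ereal ((real n / real m) powr \<delta>) * endpoint_factor m \<gamma> x))"
proof -
  have "ereal ((rho m x / rho n x) powr \<beta> / 2)
      \<le> ereal (avg_weight (pole_weight \<beta> x) n x / avg_weight (pole_weight \<beta> x) m x)"
    using avg_pole_weight_ratio_ge[of \<beta> x n m] assms by simp
  with assms(8) have "\<not> ereal (avg_weight (pole_weight \<beta> x) n x / avg_weight (pole_weight \<beta> x) m x)
      \<le> ereal ((real n / real m) powr \<delta>) * endpoint_factor m \<gamma> x"
    by (simp add: not_le less_le_trans)
  moreover have "doubling_weight (pole_weight \<beta> x)"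
    using assms by (intro doubling_weight_pole_weight) auto
  moreover have "x \<in> {-1..1}" using assms by simp
  ultimately show ?thesis using assms by blast
qed

text \<open>At 0 the endpoint factor is the constant \<open>2 powr \<gamma>\<close>, while the
  radius ratio is at least \<open>n\<close>; so any \<open>\<beta>\<close> strictly between
  \<open>\<delta>\<close> and 1 wins for large \<open>n\<close>.\<close>

lemma delta_necessary:
  fixes \<delta> \<gamma> :: real
  assumes "\<delta> < 1"
  shows "\<exists>\<beta> n. 0 \<le> \<beta> \<and> \<beta> < 1 \<and> 2 \<le> n \<and>
    ereal (real n powr \<delta>) * endpoint_factor 1 \<gamma> 0 < ereal ((rho 1 0 / rho n 0) powr \<beta> / 2)"
proof -
  obtain \<beta> where \<beta>: "max 0 \<delta> < \<beta>" "\<beta> < 1" using dense[of "max 0 \<delta>" 1] assms by auto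
  \<comment> \<open>The factor 2 absorbs the loss of 1/2 in the average estimate.\<close>
  obtain n where n: "2 \<le> n" "(2 * 2 powr \<gamma>) * real n powr \<delta> < real n powr \<beta>"
    using powr_eventually_dominates[of \<delta> \<beta>] \<beta> by auto
  have "real n \<le> rho 1 0 / rho n 0"
    using n by (simp add: rho_def field_simps power2_eq_square)
  then have "real n powr \<beta> \<le> (rho 1 0 / rho n 0) powr \<beta>"
    using \<beta> by (intro powr_mono2) auto
  with n(2) have "real n powr \<delta> * 2 powr \<gamma> < (rho 1 0 / rho n 0) powr \<beta> / 2"
    by (simp add: mult_ac)
  then show ?thesis using \<beta> n by (intro exI[of _ \<beta>] exI[of _ n]) (auto simp: endpoint_factor_def phi_def)
qed

text \<open>At \<open>phi x = 1 / n\<close> the bound is of order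
  \<open>n powr (\<delta> + \<gamma>)\<close> and the radius ratio at least \<open>n^2 / 2\<close>,
  so \<open>\<beta>\<close> is taken above \<open>(\<delta> + \<gamma>) / 2\<close>.\<close>

lemma sum_necessary:
  fixes \<delta> \<gamma> :: real
  assumes "\<delta> + \<gamma> < 2" "0 \<le> \<gamma>"
  shows "\<exists>\<beta> n x. 0 \<le> \<beta> \<and> \<beta> < 1 \<and> 2 \<le> n \<and> 0 \<le> x \<and> x \<le> 1 \<and>
    ereal (real n powr \<delta>) * endpoint_factor 1 \<gamma> x < ereal ((rho 1 x / rho n x) powr \<beta> / 2)"
proof -
  obtain \<beta> where \<beta>: "max 0 ((\<delta> + \<gamma>) / 2) < \<beta>" "\<beta> < 1"
    using dense[of "max 0 ((\<delta> + \<gamma>) / 2)" 1] assms by auto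
  \<comment> \<open>The 4 pays for the loss of 1/2 and for \<open>2 powr \<beta> \<le> 2\<close>;
    \<open>2 powr \<gamma>\<close> comes from \<open>1 + n \<le> 2 * n\<close>.\<close>
  obtain n where n: "2 \<le> n" "(4 * 2 powr \<gamma>) * real n powr (\<delta> + \<gamma>) < real n powr (2 * \<beta>)"
    using powr_eventually_dominates[of "\<delta> + \<gamma>" "2 * \<beta>"] \<beta> by auto
  \<comment> \<open>This choice makes both summands of \<open>rho n x\<close> equal to
    \<open>1 / n^2\<close>.\<close>
  define x where "x = sqrt (1 - 1 / (real n)\<^sup>2)"
  have n1: "1 / (real n)\<^sup>2 \<le> 1" using n by (auto simp: divide_le_eq_1)
  then have x2: "x\<^sup>2 = 1 - 1 / (real n)\<^sup>2" unfolding x_def by simp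
  have phi: "sqrt (1 - x\<^sup>2) = 1 / real n" by (simp add: x2 real_sqrt_divide)
  have x: "0 \<le> x" "x \<le> 1" using n1 by (auto simp: x_def)
  have ratio: "(real n)\<^sup>2 / 2 \<le> rho 1 x / rho n x"
  proof -
    have "rho n x = 2 / (real n)\<^sup>2" "rho 1 x = 1 / real n + 1"
      by (simp_all only: rho_def phi) (simp_all add: power2_eq_square)
    then have "rho 1 x / rho n x = (1 / real n + 1) * ((real n)\<^sup>2 / 2)"
      by (simp only:) simp
    moreover have "1 * ((real n)\<^sup>2 / 2) \<le> (1 / real n + 1) * ((real n)\<^sup>2 / 2)"
      by (rule mult_right_mono) auto
    ultimately show ?thesis by simp
  qed
  have "real n powr \<delta> * (1 + real n) powr \<gamma> \<le> real n powr \<delta> * (2 * real n) powr \<gamma>"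
    using n assms by (intro mult_left_mono powr_mono2) auto
  also have "\<dots> = 2 powr \<gamma> * real n powr (\<delta> + \<gamma>)"
    by (simp add: powr_mult powr_add)
  also have "\<dots> < real n powr (2 * \<beta>) / 4" using n(2) by simp
  also have "\<dots> \<le> ((real n)\<^sup>2 / 2) powr \<beta> / 2"
  proof -
    have "((real n)\<^sup>2 / 2) powr \<beta> = real n powr (2 * \<beta>) / 2 powr \<beta>"
      using n(1) powr_powr[of "real n" 2 \<beta>] by (simp add: powr_divide)
    moreover have "(2::real) powr \<beta> \<le> 2" using powr_mono[of \<beta> 1 2] \<beta> by simp
    then have "real n powr (2 * \<beta>) / 2 \<le> real n powr (2 * \<beta>) / 2 powr \<beta>"
      by (intro divide_left_mono) auto
    ultimately show ?thesis by linarith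
  qed
  also have "\<dots> \<le> (rho 1 x / rho n x) powr \<beta> / 2"
    using ratio \<beta> by (intro divide_right_mono powr_mono2) auto
  finally have "real n powr \<delta> * (1 + real n) powr \<gamma> < (rho 1 x / rho n x) powr \<beta> / 2" .
  then show ?thesis using \<beta> n x
    by (intro exI[of _ \<beta>] exI[of _ n] exI[of _ x]) (auto simp: endpoint_factor_def phi_def phi)
qed

text \<open>The endpoint factor at 1 is 0, so any positive left side will do. Exponent 0 corresponds
  to a weight equal to 1 almost everywhere on [-1,1].\<close>

lemma gamma_necessary:
  fixes \<delta> \<gamma> :: real
  assumes "\<gamma> < 0"
  shows "ereal (real 2 powr \<delta>) * endpoint_factor 1 \<gamma> 1 < ereal ((rho 1 1 / rho 2 1) powr 0 / 2)"
  using assms by (simp add: endpoint_factor_def phi_def rho_def zero_ereal_def)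

theorem lemma2p1:
  "(\<forall>(w :: real \<Rightarrow> real) (m :: nat) (n :: nat) (\<delta> :: real) (\<gamma> :: real).
      doubling_weight w \<longrightarrow> 1 \<le> m \<longrightarrow> m \<le> n \<longrightarrow> (\<delta>, \<gamma>) \<in> Upsilon \<longrightarrow>
      (\<forall>x\<in>{-1..1}. ereal (avg_weight w n x / avg_weight w m x)
                     \<le> ereal ((real n / real m) powr \<delta>) * endpoint_factor m \<gamma> x)) \<and>
   (\<forall>(\<delta> :: real) (\<gamma> :: real). (\<delta>, \<gamma>) \<notin> Upsilon \<longrightarrow>
      (\<exists>w :: real \<Rightarrow> real. doubling_weight w \<and>
        (\<exists>(m :: nat) (n :: nat). 1 \<le> m \<and> m \<le> n \<and>
          (\<exists>x\<in>{-1..1}. \<not> ereal (avg_weight w n x / avg_weight w m x)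
                          \<le> ereal ((real n / real m) powr \<delta>) * endpoint_factor m \<gamma> x))))"
proof (intro conjI allI impI ballI)
  fix w :: "real \<Rightarrow> real" and m n :: nat and \<delta> \<gamma> x :: real
  assume "doubling_weight w" "1 \<le> m" "m \<le> n" "(\<delta>, \<gamma>) \<in> Upsilon" "x \<in> {-1..1}"
  then show "ereal (avg_weight w n x / avg_weight w m x)
      \<le> ereal ((real n / real m) powr \<delta>) * endpoint_factor m \<gamma> x"
    by (intro avg_weight_ratio_le_endpoint_factor) auto
next
  fix \<delta> \<gamma> :: real
  assume "(\<delta>, \<gamma>) \<notin> Upsilon"
  \<comment> \<open>The case of a small sum keeps \<open>0 \<le> \<gamma>\<close>, which makes
    \<open>(1 + n) powr \<gamma>\<close> at most \<open>(2 * n) powr \<gamma>\<close>.\<close>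
  then consider "\<gamma> < 0" | "\<delta> < 1" | "\<delta> + \<gamma> < 2" "0 \<le> \<gamma>"
    unfolding Upsilon_def by fastforce
  then have "\<exists>\<beta> n x. 0 \<le> \<beta> \<and> \<beta> < 1 \<and> 2 \<le> n \<and> 0 \<le> x \<and> x \<le> 1 \<and>
    ereal (real n powr \<delta>) * endpoint_factor 1 \<gamma> x < ereal ((rho 1 x / rho n x) powr \<beta> / 2)"
  proof cases
    case 1
    show ?thesis
      using gamma_necessary[OF 1, of \<delta>]
      by (intro exI[of _ 0] exI[of _ 2] exI[of _ 1]) auto
  next
    case 2
    then show ?thesis using delta_necessary[of \<delta> \<gamma>]
      by (metis order_refl zero_le_one)
  next
    case 3
    then show ?thesis by (rule sum_necessary)
  qed
  then obtain \<beta> n x where *: "0 \<le> \<beta>" "\<beta> < 1" "2 \<le> n" "0 \<le> x" "x \<le> 1"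
    "ereal (real n powr \<delta>) * endpoint_factor 1 \<gamma> x < ereal ((rho 1 x / rho n x) powr \<beta> / 2)"
    by blast
  show "\<exists>w. doubling_weight w \<and>
    (\<exists>m n. 1 \<le> m \<and> m \<le> n \<and>
      (\<exists>x\<in>{-1..1}. \<not> ereal (avg_weight w n x / avg_weight w m x)
        \<le> ereal ((real n / real m) powr \<delta>) * endpoint_factor m \<gamma> x))"
    by (rule pole_weight_counterexample[of \<beta> x n 1]) (use * in auto)
qed

end
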